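(* Let $\mathcal{D}=\{(\mathbf{x}_i,y_i)\}_{i=1}^N$ be a data set with labels $y_i\in\{0,1\}$, let $f_b$ be a fixed black-box model with predictions $\hat{y}_{b,i}=f_b(\mathbf{x}_i)\in\{0,1\}$ on $\mathcal{D}$, and let $\theta_1>0$, $\theta_2\ge 0$. Let $\mathcal{R}^*$ be a minimizer of $\Lambda(\mathcal{R})=\Lambda(\langle\mathcal{R},f_b\rangle,\mathcal{D})$ over all hybrid rule sets $\mathcal{R}=\mathcal{R}_+\cup\mathcal{R}_-$. Let $\mathcal{R}_{[0]},\mathcal{R}_{[1]},\dots,\mathcal{R}_{[t]}$ be the hybrid rule sets visited by the search up to time $t$ (starting from $\mathcal{R}_{[0]}=\emptyset$), and let $\lambda^*_{[t]}=\min_{\tau\le t}\Lambda(\mathcal{R}_{[\tau]})$ be the best objective value found up to time $t$. Then $$\Omega(\mathcal{R}^* )\le \frac{\lambda^*_{[t]}+\theta_2}{\theta_1}.$$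
   Context: A rule $r$ is a conjunction of conditions on the attributes of an input $\mathbf{x}\in\mathcal{X}$; $\mathrm{covers}(r,\mathbf{x})=1$ if $\mathbf{x}$ obeys $r$ and $0$ otherwise. For a finite set of rules $R$, $\mathrm{covers}(R,\mathbf{x})=1$ if $\mathbf{x}$ obeys at least one rule of $R$, and $0$ otherwise. The support of a rule set in $\mathcal{D}$ is the set of covered observations: $\mathrm{support}(R,\mathcal{D})=\{i : \mathrm{covers}(R,\mathbf{x}_i)=1\}$; $|\cdot|$ denotes cardinality. A hybrid rule sets model $\langle\mathcal{R},f_b\rangle$ consists of a finite positive rule set $\mathcal{R}_+$, a finite negative rule set $\mathcal{R}_-$, with $\mathcal{R}=\mathcal{R}_+\cup\mathcal{R}_-$, and the black-box $f_b$. It predicts $1$ if $\mathbf{x}$ is covered by $\mathcal{R}_+$; otherwise $0$ if $\mathbf{x}$ is covered by $\mathcal{R}_-$; otherwise $f_b(\mathbf{x})$. The misclassification error is $$\ell(\langle\mathcal{R},f_b\rangle,\mathcal{D})=\frac1N\sum_{i=1}^N\Big[(1-y_i)\,\mathrm{covers}(\mathcal{R}_+,\mathbf{x}_i)+y_i\big(1-\mathrm{covers}(\mathcal{R}_+,\mathbf{x}_i)\big)\mathrm{covers}(\mathcal{R}_-,\mathbf{x}_i)+\big(1-\mathrm{covers}(\mathcal{R}_+,\mathbf{x}_i)\big)\big(1-\mathrm{covers}(\mathcal{R}_-,\mathbf{x}_i)\big)\big(y_i(1-\hat{y}_{b,i})+(1-y_i)\hat{y}_{b,i}\big)\Big].$$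 $\Omega(\mathcal{R})$ denotes the number of rules in $\mathcal{R}$. The objective, to be minimized, is $$\Lambda(\langle\mathcal{R},f_b\rangle,\mathcal{D})=\ell(\langle\mathcal{R},f_b\rangle,\mathcal{D})+\theta_1\Omega(\mathcal{R})-\theta_2\frac{|\mathrm{support}(\mathcal{R},\mathcal{D})|}{N}.$$ The search is a stochastic local search over hybrid rule sets started at $\mathcal{R}_{[0]}=\emptyset$ (the pure black-box model); at each iteration a neighbor of the current state, obtained by adding or removing one rule, is proposed and accepted or rejected at random. *)

theory Defs
  imports Complex_Main "HOL-Library.FSet"
begin

text \<open>An input assigns a value to every attribute. A condition \<open>(a, V)\<close> requires the value
  of attribute \<open>a\<close> to lie in \<open>V\<close>; this covers equality tests as well as thresholds. A rule is
  the conjunction of a finite set of conditions.\<close>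

type_synonym ('a, 'v) input = "'a \<Rightarrow> 'v"
type_synonym ('a, 'v) condition = "'a \<times> 'v set"
type_synonym ('a, 'v) rule = "('a, 'v) condition fset"

text \<open>Labels and predictions are real numbers, so that the loss can be written arithmetically;
  that they lie in \<open>{0, 1}\<close> has to be assumed where it is meant.\<close>

type_synonym ('a, 'v) dataset = "(('a, 'v) input \<times> real) list"

datatype ('a, 'v) hybrid = Hybrid (pos_rules: "('a, 'v) rule set") (neg_rules: "('a, 'v) rule set")

definition all_rules :: "('a, 'v) hybrid \<Rightarrow> ('a, 'v) rule set" where
  "all_rules R = pos_rules R \<union> neg_rules R"

text \<open>The set \<open>L\<close> is the rule language, i.e. the rules that are available; \<open>L = UNIV\<close> imposes
  no restriction.\<close>

definition hybrid_rule_sets :: "('a, 'v) rule set \<Rightarrow> ('a, 'v) hybrid set" where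
  "hybrid_rule_sets L =
     {R. finite (pos_rules R) \<and> finite (neg_rules R) \<and> all_rules R \<subseteq> L}"

definition rule_covers :: "('a, 'v) rule \<Rightarrow> ('a, 'v) input \<Rightarrow> real" where
  "rule_covers r x = (if \<forall>(a, V) \<in> fset r. x a \<in> V then 1 else 0)"

definition covers :: "('a, 'v) rule set \<Rightarrow> ('a, 'v) input \<Rightarrow> real" where
  "covers S x = (if \<exists>r\<in>S. rule_covers r x = 1 then 1 else 0)"

definition support :: "('a, 'v) rule set \<Rightarrow> ('a, 'v) dataset \<Rightarrow> nat set" where
  "support S D = {i. i < length D \<and> covers S (fst (D ! i)) = 1}"

definition predict :: "('a, 'v) hybrid \<Rightarrow> (('a, 'v) input \<Rightarrow> real) \<Rightarrow> ('a, 'v) input \<Rightarrow> real" where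
  "predict R f\<^sub>b x =
     (if covers (pos_rules R) x = 1 then 1
      else if covers (neg_rules R) x = 1 then 0
      else f\<^sub>b x)"

definition misclass_error ::
    "('a, 'v) hybrid \<Rightarrow> (('a, 'v) input \<Rightarrow> real) \<Rightarrow> ('a, 'v) dataset \<Rightarrow> real" where
  "misclass_error R f\<^sub>b D =
     1 / real (length D) *
     (\<Sum>i<length D.
        let x = fst (D ! i); y = snd (D ! i);
            cp = covers (pos_rules R) x; cn = covers (neg_rules R) x
        in (1 - y) * cp
           + y * (1 - cp) * cn
           + (1 - cp) * (1 - cn) * (y * (1 - f\<^sub>b x) + (1 - y) * f\<^sub>b x))"

lemma misclass_error_eq_card:
  assumes "\<And>x y. (x, y) \<in> set D \<Longrightarrow> y \<in> {0, 1} \<and> f\<^sub>b x \<in> {0, 1}"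
  shows "misclass_error R f\<^sub>b D =
           card {i. i < length D \<and> predict R f\<^sub>b (fst (D ! i)) \<noteq> snd (D ! i)} / length D"
proof -
  have "(let x = fst (D ! i); y = snd (D ! i);
            cp = covers (pos_rules R) x; cn = covers (neg_rules R) x
        in (1 - y) * cp + y * (1 - cp) * cn
           + (1 - cp) * (1 - cn) * (y * (1 - f\<^sub>b x) + (1 - y) * f\<^sub>b x)) =
        (if predict R f\<^sub>b (fst (D ! i)) \<noteq> snd (D ! i) then 1 else 0)"
    if "i < length D" for i
  proof -
    have "snd (D ! i) \<in> {0, 1} \<and> f\<^sub>b (fst (D ! i)) \<in> {0, 1}"
      using assms[of "fst (D ! i)" "snd (D ! i)"] nth_mem[OF that] by simp
    then show ?thesis
      by (auto simp: Let_def predict_def covers_def)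
  qed
  then have "misclass_error R f\<^sub>b D = 1 / length D *
      (\<Sum>i<length D. if predict R f\<^sub>b (fst (D ! i)) \<noteq> snd (D ! i) then 1 else 0)"
    unfolding misclass_error_def by simp
  also have "\<dots> = card {i. i < length D \<and> predict R f\<^sub>b (fst (D ! i)) \<noteq> snd (D ! i)} / length D"
    by (simp add: sum.If_cases Int_def lessThan_def)
  finally show ?thesis .
qed

definition num_rules :: "('a, 'v) hybrid \<Rightarrow> nat" where
  "num_rules R = card (all_rules R)"

definition objective ::
    "real \<Rightarrow> real \<Rightarrow> (('a, 'v) input \<Rightarrow> real) \<Rightarrow> ('a, 'v) dataset \<Rightarrow> ('a, 'v) hybrid \<Rightarrow> real" where
  "objective \<theta>\<^sub>1 \<theta>\<^sub>2 f\<^sub>b D R =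
     misclass_error R f\<^sub>b D + \<theta>\<^sub>1 * real (num_rules R)
     - \<theta>\<^sub>2 * (real (card (support (all_rules R) D)) / real (length D))"

definition neighbors :: "('a, 'v) rule set \<Rightarrow> ('a, 'v) hybrid \<Rightarrow> ('a, 'v) hybrid set" where
  "neighbors L R =
     {Hybrid (insert r (pos_rules R)) (neg_rules R) | r. r \<in> L - pos_rules R} \<union>
     {Hybrid (pos_rules R) (insert r (neg_rules R)) | r. r \<in> L - neg_rules R} \<union>
     {Hybrid (pos_rules R - {r}) (neg_rules R) | r. r \<in> pos_rules R} \<union>
     {Hybrid (pos_rules R) (neg_rules R - {r}) | r. r \<in> neg_rules R}"

text \<open>\<open>S 0, \<dots>, S t\<close> is a possible realization of the random search: each step either accepts
  the proposed neighbor or rejects it and keeps the current state. The proposal and acceptance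
  probabilities only determine how likely a realization is.\<close>

definition search_trajectory :: "('a, 'v) rule set \<Rightarrow> nat \<Rightarrow> (nat \<Rightarrow> ('a, 'v) hybrid) \<Rightarrow> bool" where
  "search_trajectory L t S \<longleftrightarrow>
     S 0 = Hybrid {} {} \<and>
     (\<forall>\<tau><t. S (Suc \<tau>) \<in> neighbors L (S \<tau>) \<or> S (Suc \<tau>) = S \<tau>)"

definition best_objective :: "(('a, 'v) hybrid \<Rightarrow> real) \<Rightarrow> (nat \<Rightarrow> ('a, 'v) hybrid) \<Rightarrow> nat \<Rightarrow> real" where
  "best_objective obj S t = Min ((\<lambda>\<tau>. obj (S \<tau>)) ` {..t})"

end

theory Submission
  imports Defs
begin

text \<open>The loss is nonnegative and the covered fraction is at most one, so any rule set satisfies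
  \<open>\<theta>\<^sub>1 * num_rules R - \<theta>\<^sub>2 \<le> objective R\<close>; an optimal rule set moreover has an objective value
  no larger than that of any visited state.\<close>

text \<open>With labels and predictions in {0, 1} the arithmetic loss is a count of misclassified
  observations divided by \<open>length D\<close>. For arbitrary real labels its summands could be
  negative.\<close>

lemma misclass_error_nonneg:
  assumes "\<And>x y. (x, y) \<in> set D \<Longrightarrow> y \<in> {0, 1} \<and> f\<^sub>b x \<in> {0, 1}"
  shows "misclass_error R f\<^sub>b D \<ge> 0"
  by (subst misclass_error_eq_card[OF assms]) auto

lemma card_support_le: "card (support A D) \<le> length D"
  using card_mono[of "{..<length D}" "support A D"] by (auto simp: support_def)

lemma objective_ge:
  assumes "\<And>x y. (x, y) \<in> set D \<Longrightarrow> y \<in> {0, 1} \<and> f\<^sub>b x \<in> {0, 1}" and "\<theta>\<^sub>2 \<ge> 0"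
  shows "\<theta>\<^sub>1 * real (num_rules R) - \<theta>\<^sub>2 \<le> objective \<theta>\<^sub>1 \<theta>\<^sub>2 f\<^sub>b D R"
proof -
  \<comment> \<open>For empty \<open>D\<close> the quotient is 0 by the convention x / 0 = 0, so the
    bound covers that case too.\<close>
  have "real (card (support (all_rules R) D)) / real (length D) \<le> 1"
    using card_support_le[of "all_rules R" D] by (simp add: divide_le_eq_1)
  then have "\<theta>\<^sub>2 * (real (card (support (all_rules R) D)) / real (length D)) \<le> \<theta>\<^sub>2"
    using \<open>\<theta>\<^sub>2 \<ge> 0\<close> mult_left_mono by fastforce
  moreover have "misclass_error R f\<^sub>b D \<ge> 0"
    using assms(1) by (rule misclass_error_nonneg)
  ultimately show ?thesis
    unfolding objective_def by linarith
qed

lemma neighbors_hybrid_rule_sets: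
  assumes "R \<in> hybrid_rule_sets L" and "R' \<in> neighbors L R"
  shows "R' \<in> hybrid_rule_sets L"
  using assms by (auto simp: neighbors_def hybrid_rule_sets_def all_rules_def)

text \<open>Optimality only allows comparison with members of \<open>hybrid_rule_sets L\<close>, so
  the visited states must be shown to be among them. The search starts from empty rule sets, and
  each accepted move deletes a rule or inserts one taken from \<open>L\<close>, which preserves
  finiteness and inclusion in \<open>L\<close>.\<close>

lemma search_trajectory_hybrid_rule_sets:
  assumes "search_trajectory L t S" and "\<tau> \<le> t"
  shows "S \<tau> \<in> hybrid_rule_sets L"
  using assms(2)
proof (induction \<tau>)
  case 0
  then show ?case
    using assms(1) by (simp add: search_trajectory_def hybrid_rule_sets_def all_rules_def)
next
  case (Suc \<tau>)
  then have "S \<tau> \<in> hybrid_rule_sets L"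
    by simp
  moreover have "S (Suc \<tau>) \<in> neighbors L (S \<tau>) \<or> S (Suc \<tau>) = S \<tau>"
    using assms(1) Suc.prems by (simp add: search_trajectory_def)
  ultimately show ?case
    using neighbors_hybrid_rule_sets by metis
qed

text \<open>The minimum ranges over a finite nonempty set, since \<open>{..t}\<close> contains 0.
  The best value can thus be traded for the value at a single visited state.\<close>

lemma best_objective_attained: "\<exists>\<tau>\<le>t. best_objective obj S t = obj (S \<tau>)"
proof -
  have "best_objective obj S t \<in> (\<lambda>\<tau>. obj (S \<tau>)) ` {..t}"
    unfolding best_objective_def by (intro Min_in) auto
  then show ?thesis
    by auto
qed

theorem theorem2:
  fixes D :: "('a, 'v) dataset"
    and f\<^sub>b :: "('a, 'v) input \<Rightarrow> real"
    and L :: "('a, 'v) rule set"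
    and \<theta>\<^sub>1 \<theta>\<^sub>2 :: real
    and Rstar :: "('a, 'v) hybrid"
    and S :: "nat \<Rightarrow> ('a, 'v) hybrid"
    and t :: nat
  assumes "D \<noteq> []"
    and "\<And>x y. (x, y) \<in> set D \<Longrightarrow> y \<in> {0, 1}"
    and "\<And>x y. (x, y) \<in> set D \<Longrightarrow> f\<^sub>b x \<in> {0, 1}"
    and "\<theta>\<^sub>1 > 0" and "\<theta>\<^sub>2 \<ge> 0"
    and "is_arg_min (objective \<theta>\<^sub>1 \<theta>\<^sub>2 f\<^sub>b D) (\<lambda>R. R \<in> hybrid_rule_sets L) Rstar"
    and "search_trajectory L t S"
  shows "real (num_rules Rstar) \<le> (best_objective (objective \<theta>\<^sub>1 \<theta>\<^sub>2 f\<^sub>b D) S t + \<theta>\<^sub>2) / \<theta>\<^sub>1"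
proof -
  let ?obj = "objective \<theta>\<^sub>1 \<theta>\<^sub>2 f\<^sub>b D"
  obtain \<tau> where "\<tau> \<le> t" and best: "best_objective ?obj S t = ?obj (S \<tau>)"
    using best_objective_attained by blast
  have "S \<tau> \<in> hybrid_rule_sets L"
    using search_trajectory_hybrid_rule_sets[OF assms(7) \<open>\<tau> \<le> t\<close>] .
  \<comment> \<open>\<open>is_arg_min\<close> only excludes strictly smaller values; linearity of
    the order on the reals turns this into \<le>.\<close>
  then have "?obj Rstar \<le> ?obj (S \<tau>)"
    using assms(6) by (auto simp: is_arg_min_def not_less)
  moreover have "\<theta>\<^sub>1 * real (num_rules Rstar) - \<theta>\<^sub>2 \<le> ?obj Rstar"
    using assms(2,3,5) by (intro objective_ge) blast+
  ultimately have "\<theta>\<^sub>1 * real (num_rules Rstar) \<le> best_objective ?obj S t + \<theta>\<^sub>2"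
    using best by linarith
  then show ?thesis
    using \<open>\<theta>\<^sub>1 > 0\<close> by (simp add: pos_le_divide_eq mult.commute)
qed

end
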